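(* Let $\mathcal N$ be any of the three nonlinearities (classical, RSLM, BBLM) of the context. The low-rank algorithm of the context can be reformulated as the following finite element scheme: given $\boldsymbol w_h^{\mathfrak n}=\Phi(x)^\top U_{\mathfrak n}S_{\mathfrak n}V_{\mathfrak n}^\top\Psi(y)\in Q_0^{\mathfrak n,k}$, find $\boldsymbol w_h^{\mathfrak n+1}=\Phi(x)^\top U_{\mathfrak n+1}S_{\mathfrak n+1}V_{\mathfrak n+1}^\top\Psi(y)\in Q_0^{\mathfrak n+1,k}$ such that $$\boldsymbol w_S^{\mathfrak n,1}=e^{\frac\tau2\epsilon^2\mathcal L_h}\boldsymbol w_h^{\mathfrak n},$$ $$(\boldsymbol w_{\overline S}^{\mathfrak n,2},\boldsymbol w_2)_h=(\boldsymbol w_S^{\mathfrak n,1},\boldsymbol w_2)_h+\tau(\mathcal N(\boldsymbol w_S^{\mathfrak n,1}),\boldsymbol w_2)_h\quad\forall\boldsymbol w_2\in\overline Q_3^{\mathfrak n,k},$$ $$(\boldsymbol w_{\overline S}^{\mathfrak n,3},\boldsymbol w_3)_h=\tfrac12(\boldsymbol w_S^{\mathfrak n,1},\boldsymbol w_3)_h+\tfrac12(\boldsymbol w_{\overline S}^{\mathfrak n,2},\boldsymbol w_3)_h+\tfrac\tau2(\mathcal N(\boldsymbol w_{\overline S}^{\mathfrak n,2}),\boldsymbol w_3)_h\quad\forall\boldsymbol w_3\in\overline Q_3^{\mathfrak n,k},$$ $$\boldsymbol w_h^{\mathfrak n+1}=e^{\frac\tau2\epsilon^2\mathcal L_h}\boldsymbol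 w_S^{\mathfrak n,3}.$$ Here $\boldsymbol w_S^{\mathfrak n,1}=\Phi^\top U_{\mathfrak n,1}S_{\mathfrak n,1}V_{\mathfrak n,1}^\top\Psi\in Q_1^{\mathfrak n,k}$, $\boldsymbol w_{\overline S}^{\mathfrak n,2}=\Phi^\top\overline U_{\mathfrak n,3}\overline S_{\mathfrak n,2}\overline V_{\mathfrak n,3}^\top\Psi\in\overline Q_3^{\mathfrak n,k}$, $\boldsymbol w_{\overline S}^{\mathfrak n,3}=\Phi^\top\overline U_{\mathfrak n,3}\overline S_{\mathfrak n,3}\overline V_{\mathfrak n,3}^\top\Psi\in\overline Q_3^{\mathfrak n,k}$, $\boldsymbol w_S^{\mathfrak n,3}=\Phi^\top U_{\mathfrak n,3}S_{\mathfrak n,3}V_{\mathfrak n,3}^\top\Psi\in Q_3^{\mathfrak n,k}$, and $\boldsymbol w_S^{\mathfrak n,3}$ is the truncation of $\boldsymbol w_{\overline S}^{\mathfrak n,3}$ given by the truncation step of the algorithm. That is, with the bases $\overline U_{\mathfrak n,3},\overline V_{\mathfrak n,3}$ produced by the algorithm, the linear steps and the two $\overline S$-updates of the algorithm are equivalent to these four relations.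
   Context: Discretization. $\Omega=[a,b]\times[c,d]$; $k,M,N\ge 1$ integers, $m=Mk+1$, $n=Nk+1$. $[a,b]$ is divided into $M$ equal subintervals and $[c,d]$ into $N$ equal subintervals; $x_1<\dots<x_m$ (resp. $y_1<\dots<y_n$) are the points obtained by placing the $(k+1)$-point Gauss–Lobatto points on every subinterval (shared endpoints counted once). $V_{x,h}^k$, $V_{y,h}^k$ are the spaces of continuous piecewise polynomials of degree $\le k$ on these partitions, $Q_h^k=V_{x,h}^k\otimes V_{y,h}^k$. $\{\phi_i\}_{i=1}^m$, $\{\psi_j\}_{j=1}^n$ are the Lagrange nodal bases ($\phi_i(x_l)=\delta_{il}$, $\psi_j(y_q)=\delta_{jq}$), $\Phi=[\phi_1,\dots,\phi_m]^\top$, $\Psi=[\psi_1,\dots,\psi_n]^\top$. $(f,g)_h$ denotes the composite (element by element) $(k+1)$-point (tensor-product) Gauss–Lobatto quadrature approximation of $\int fg$, in one or two dimensions. $M_x=[(\phi_i,\phi_j)_h]$, $M_y=[(\psi_i,\psi_j)_h]$ (diagonal), $A_x=[(\partial_x\phi_i,\partial_x\phi_j)_h]$, $A_y=[(\partial_y\psi_i,\partial_y\psi_j)_h]$, $L_x=-M_x^{-1}A_x$, $L_y=-M_y^{-1}A_y$. The coefficient matrix of $w_h\in Q_h^k$ is $W\in\mathbb R^{m\times n}$ with $w_h=\Phi(x)^\top W\Psi(y)$, and $e^{s\mathcal L_h}w_h=\Phi(x)^\top e^{sL_x}We^{sL_y^\top}\Psi(y)$. $(A,B)_{\rm F}=\mathrm{tr}(A^\top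 B)$, $(A,B)_{\rm M}=(M_xAM_y,B)_{\rm F}$. $\mathbf I=q_mq_n^\top\in\mathbb R^{m\times n}$ is the all-ones matrix, $q_m,q_n$ all-ones vectors. $W^{\circ s}$ is the entrywise power. Nonlinearity. Classical: $\mathcal N(W)=W-W^{\circ3}$. RSLM: $\mathcal N(W)=W-W^{\circ3}-\frac1{|\Omega|}(W-W^{\circ3},\mathbf I)_{\rm M}\,\mathbf I$. BBLM: $\mathcal N(W)=W-W^{\circ3}-\frac{(W-W^{\circ3},\mathbf I)_{\rm M}}{(\mathbf I-W^{\circ2},\mathbf I)_{\rm M}}(\mathbf I-W^{\circ2})$ (denominator nonzero wherever used). For $w\in Q_h^k$ with coefficient matrix $W$, $\mathcal N(w)$ is the function with nodal values $\mathcal N(W)$. Subspaces. $Q_0^{\mathfrak n,k}=\{\Phi^\top U_{\mathfrak n}SV_{\mathfrak n}^\top\Psi:S\in\mathbb R^{r\times r}\}$, $Q_1^{\mathfrak n,k}=\{\Phi^\top U_{\mathfrak n,1}SV_{\mathfrak n,1}^\top\Psi:S\in\mathbb R^{r\times r}\}$, $\overline Q_3^{\mathfrak n,k}=\{\Phi^\top\overline U_{\mathfrak n,3}S\overline V_{\mathfrak n,3}^\top\Psi:S\in\mathbb R^{\bar r\times\bar r}\}$, $Q_3^{\mathfrak n,k}=\{\Phi^\top U_{\mathfrak n,3}SV_{\mathfrak n,3}^\top\Psi:S\in\mathbb R^{\tilde r\times\tilde r}\}$. Algorithm (one step; $\epsilon>0$, time step $\tau>0$, tolerance $\eta\geq 0$).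 $\mathrm{GQR}(A,M)$ is a factorization $A=QR$ with $Q^\top MQ=I$; it returns $Q$ (and $R$). Input $U_{\mathfrak n}\in\mathbb R^{m\times r}$, $S_{\mathfrak n}\in\mathbb R^{r\times r}$, $V_{\mathfrak n}\in\mathbb R^{n\times r}$ with $U_{\mathfrak n}^\top M_xU_{\mathfrak n}=V_{\mathfrak n}^\top M_yV_{\mathfrak n}=I_r$. (1) Linear step: $[U_{\mathfrak n,1},R]=\mathrm{GQR}(e^{\frac\tau2\epsilon^2L_x}U_{\mathfrak n},M_x)$, $[V_{\mathfrak n,1},P]=\mathrm{GQR}(e^{\frac\tau2\epsilon^2L_y}V_{\mathfrak n},M_y)$, $S_{\mathfrak n,1}=RS_{\mathfrak n}P^\top$, $\mathcal W_{\mathfrak n,1}=U_{\mathfrak n,1}S_{\mathfrak n,1}V_{\mathfrak n,1}^\top$. (2) First-order augmented BUG step: $K=U_{\mathfrak n,1}S_{\mathfrak n,1}+\tau\mathcal N(\mathcal W_{\mathfrak n,1})M_yV_{\mathfrak n,1}$, $L=V_{\mathfrak n,1}S_{\mathfrak n,1}^\top+\tau\mathcal N(\mathcal W_{\mathfrak n,1})^\top M_xU_{\mathfrak n,1}$; $U_{\mathfrak n,2}=\mathrm{GQR}([K,U_{\mathfrak n,1}],M_x)$, $V_{\mathfrak n,2}=\mathrm{GQR}([L,V_{\mathfrak n,1}],M_y)$; $S_*=(U_{\mathfrak n,2}^\top M_xU_{\mathfrak n,1})S_{\mathfrak n,1}(V_{\mathfrak n,2}^\top M_yV_{\mathfrak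 n,1})^\top$; $S_{\mathfrak n,2}=S_*+\tau U_{\mathfrak n,2}^\top M_x\mathcal N(U_{\mathfrak n,2}S_*V_{\mathfrak n,2}^\top)M_yV_{\mathfrak n,2}$; $\mathcal W_{\mathfrak n,2}=U_{\mathfrak n,2}S_{\mathfrak n,2}V_{\mathfrak n,2}^\top$. (3) Galerkin step: $\mathbb U=[q_m,U_{\mathfrak n,1},\tau\mathcal N(\mathcal W_{\mathfrak n,1})V_{\mathfrak n,1},\tau\mathcal N(\mathcal W_{\mathfrak n,2})V_{\mathfrak n,2}]$, $\mathbb V=[q_n,V_{\mathfrak n,1},\tau\mathcal N(\mathcal W_{\mathfrak n,1})^\top U_{\mathfrak n,1},\tau\mathcal N(\mathcal W_{\mathfrak n,2})^\top U_{\mathfrak n,2}]$; $\overline U_{\mathfrak n,3}=\mathrm{GQR}(\mathbb U,M_x)$, $\overline V_{\mathfrak n,3}=\mathrm{GQR}(\mathbb V,M_y)$ (with $\bar r\le4r+1$ columns); $\overline S_{\mathfrak n,1}=(\overline U_{\mathfrak n,3}^\top M_xU_{\mathfrak n,1})S_{\mathfrak n,1}(\overline V_{\mathfrak n,3}^\top M_yV_{\mathfrak n,1})^\top$; $\overline S_{\mathfrak n,2}=\overline S_{\mathfrak n,1}+\tau\overline U_{\mathfrak n,3}^\top M_x\mathcal N(\overline U_{\mathfrak n,3}\overline S_{\mathfrak n,1}\overline V_{\mathfrak n,3}^\top)M_y\overline V_{\mathfrak n,3}$; $\overline S_{\mathfrak n,3}=\frac12\overline S_{\mathfrak n,1}+\frac12\overline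 S_{\mathfrak n,2}+\frac\tau2\overline U_{\mathfrak n,3}^\top M_x\mathcal N(\overline U_{\mathfrak n,3}\overline S_{\mathfrak n,2}\overline V_{\mathfrak n,3}^\top)M_y\overline V_{\mathfrak n,3}$. (4) Truncation: SVD $\overline S_{\mathfrak n,3}=\overline R\,\overline\Sigma\,\overline P^\top$, $\overline\Sigma=\mathrm{diag}(\sigma_i)$ with $\sigma_i$ non-increasing; choose a rank $\tilde r$ (the original $r$ or a new one) with $\big(\sum_{i=\tilde r+1}^{\bar r}\sigma_i^2\big)^{1/2}\le\eta$; $S_{\mathfrak n,3}=\mathrm{diag}(\sigma_1,\dots,\sigma_{\tilde r})$, $U_{\mathfrak n,3}=\overline U_{\mathfrak n,3}R'$, $V_{\mathfrak n,3}=\overline V_{\mathfrak n,3}P'$ where $R',P'$ are the first $\tilde r$ columns of $\overline R,\overline P$. (5) Linear step: apply (1) to $(U_{\mathfrak n,3},S_{\mathfrak n,3},V_{\mathfrak n,3})$ to get $(U_{\mathfrak n+1},S_{\mathfrak n+1},V_{\mathfrak n+1})$. (In $Q_0^{\mathfrak n+1,k}$ the rank is that of the new factors.) *)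

theory Defs
  imports
    "HOL-Analysis.Analysis"
    "Jordan_Normal_Form.Gauss_Jordan_Elimination"
begin

section \<open>Matrices\<close>

text \<open>Matrices are those of Jordan Normal Form, so that all dimensions and ranks are natural
  numbers; rows and columns are counted from 0.\<close>

definition mat_trace :: "real mat \<Rightarrow> real" where
  "mat_trace A = (\<Sum>i<dim_row A. A $$ (i, i))"

definition mat_exp :: "real mat \<Rightarrow> real mat" where
  "mat_exp A = Matrix.mat (dim_row A) (dim_row A)
     (\<lambda>(i, j). \<Sum>l. (A ^\<^sub>m l) $$ (i, j) / fact l)"

definition mat_inv :: "real mat \<Rightarrow> real mat" where
  "mat_inv A = the (mat_inverse A)"

definition hadamard_pow :: "real mat \<Rightarrow> nat \<Rightarrow> real mat" where
  "hadamard_pow W s = map_mat (\<lambda>x. x ^ s) W"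

definition ones_mat :: "nat \<Rightarrow> nat \<Rightarrow> real mat" where
  "ones_mat m n = Matrix.mat m n (\<lambda>_. 1)"

definition first_cols :: "nat \<Rightarrow> real mat \<Rightarrow> real mat" where
  "first_cols q A = Matrix.mat (dim_row A) q (\<lambda>(i, j). A $$ (i, j))"

text \<open>\<open>gqr A M Q R\<close> says that \<open>(Q, R)\<close> is an admissible output of \<open>GQR(A, M)\<close>. A relation is used
  because such a factorization is not unique. It is thin: \<open>Q\<close> has at most as many columns
  as \<open>A\<close>, and possibly fewer when \<open>A\<close> is rank deficient.\<close>

definition gqr :: "real mat \<Rightarrow> real mat \<Rightarrow> real mat \<Rightarrow> real mat \<Rightarrow> bool" where
  "gqr A M Q R \<longleftrightarrow>
     Q \<in> carrier_mat (dim_row A) (dim_col Q) \<and> R \<in> carrier_mat (dim_col Q) (dim_col A) \<and>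
     dim_col Q \<le> dim_col A \<and>
     A = Q * R \<and> transpose_mat Q * M * Q = 1\<^sub>m (dim_col Q)"

definition is_svd :: "real mat \<Rightarrow> real mat \<Rightarrow> (nat \<Rightarrow> real) \<Rightarrow> real mat \<Rightarrow> bool" where
  "is_svd S R \<sigma> P \<longleftrightarrow> (let q = dim_row S in
     S \<in> carrier_mat q q \<and> R \<in> carrier_mat q q \<and> P \<in> carrier_mat q q \<and>
     transpose_mat R * R = 1\<^sub>m q \<and> transpose_mat P * P = 1\<^sub>m q \<and>
     (\<forall>i<q. 0 \<le> \<sigma> i) \<and> (\<forall>i j. i \<le> j \<and> j < q \<longrightarrow> \<sigma> j \<le> \<sigma> i) \<and>
     S = R * mat_diag q \<sigma> * transpose_mat P)"


section \<open>One-dimensional discretization\<close>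

text \<open>The \<open>(k+1)\<close>-point Gauss--Lobatto rule on \<open>[-1, 1]\<close>: both endpoints are nodes, and the rule is
  exact for polynomials of degree at most \<open>2k - 1\<close>. This determines the nodes
  \<open>\<xi> 0 < \<dots> < \<xi> k\<close> and the weights \<open>\<omega> 0, \<dots>, \<omega> k\<close>.\<close>

definition gauss_lobatto :: "nat \<Rightarrow> (nat \<Rightarrow> real) \<Rightarrow> (nat \<Rightarrow> real) \<Rightarrow> bool" where
  "gauss_lobatto k \<xi> \<omega> \<longleftrightarrow>
     \<xi> 0 = -1 \<and> \<xi> k = 1 \<and> strict_mono_on {0..k} \<xi> \<and>
     (\<forall>p :: real poly. degree p \<le> 2 * k - 1 \<longrightarrow>
        integral {-1..1} (poly p) = (\<Sum>j\<le>k. \<omega> j * poly p (\<xi> j)))"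

record fe1d =
  fe_lo :: real
  fe_hi :: real
  fe_deg :: nat
  fe_cells :: nat
  ref_node :: "nat \<Rightarrow> real"
  ref_weight :: "nat \<Rightarrow> real"
  fe_basis :: "nat \<Rightarrow> real \<Rightarrow> real"

definition mesh_width :: "fe1d \<Rightarrow> real" where
  "mesh_width X = (fe_hi X - fe_lo X) / real (fe_cells X)"

definition cell :: "fe1d \<Rightarrow> nat \<Rightarrow> real set" where
  "cell X e = {fe_lo X + real e * mesh_width X .. fe_lo X + real (e + 1) * mesh_width X}"

definition cell_point :: "fe1d \<Rightarrow> nat \<Rightarrow> nat \<Rightarrow> real" where
  "cell_point X e p = fe_lo X + real e * mesh_width X + mesh_width X / 2 * (1 + ref_node X p)"

definition npts :: "fe1d \<Rightarrow> nat" where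
  "npts X = fe_cells X * fe_deg X + 1"

text \<open>Since the last node of a cell is the first node of the next one, numbering the nodes as
  \<open>i = e * k + p\<close> with \<open>p < k\<close> counts shared endpoints once; the last index \<open>i = M * k\<close> yields the
  right end of the interval.\<close>

definition node :: "fe1d \<Rightarrow> nat \<Rightarrow> real" where
  "node X i = cell_point X (i div fe_deg X) (i mod fe_deg X)"

definition fe_space1 :: "fe1d \<Rightarrow> (real \<Rightarrow> real) set" where
  "fe_space1 X = {f. continuous_on {fe_lo X..fe_hi X} f \<and>
     (\<forall>e<fe_cells X. \<exists>p :: real poly. degree p \<le> fe_deg X \<and> (\<forall>x\<in>cell X e. f x = poly p x))}"

definition fe_discretization :: "fe1d \<Rightarrow> bool" where
  "fe_discretization X \<longleftrightarrow>
     fe_lo X < fe_hi X \<and> 1 \<le> fe_deg X \<and> 1 \<le> fe_cells X \<and>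
     gauss_lobatto (fe_deg X) (ref_node X) (ref_weight X) \<and>
     (\<forall>i<npts X. fe_basis X i \<in> fe_space1 X \<and>
        (\<forall>l<npts X. fe_basis X i (node X l) = (if i = l then 1 else 0)))"

text \<open>Composite quadrature. The integrand may depend on the cell, as is needed for derivatives of
  piecewise polynomials, which take two values at an interface node.\<close>

definition quad1 :: "fe1d \<Rightarrow> (nat \<Rightarrow> real \<Rightarrow> real) \<Rightarrow> real" where
  "quad1 X g = (\<Sum>e<fe_cells X. \<Sum>p\<le>fe_deg X.
     mesh_width X / 2 * ref_weight X p * g e (cell_point X e p))"

definition cell_deriv :: "fe1d \<Rightarrow> nat \<Rightarrow> (real \<Rightarrow> real) \<Rightarrow> real \<Rightarrow> real" where
  "cell_deriv X e f x = vector_derivative f (at x within cell X e)"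

definition mass :: "fe1d \<Rightarrow> real mat" where
  "mass X = Matrix.mat (npts X) (npts X)
     (\<lambda>(i, j). quad1 X (\<lambda>e x. fe_basis X i x * fe_basis X j x))"

definition stiffness :: "fe1d \<Rightarrow> real mat" where
  "stiffness X = Matrix.mat (npts X) (npts X)
     (\<lambda>(i, j). quad1 X (\<lambda>e x. cell_deriv X e (fe_basis X i) x * cell_deriv X e (fe_basis X j) x))"

definition discrete_laplacian :: "fe1d \<Rightarrow> real mat" where
  "discrete_laplacian X = - (mat_inv (mass X) * stiffness X)"


section \<open>Two-dimensional discretization\<close>

definition fe_domain :: "fe1d \<Rightarrow> fe1d \<Rightarrow> (real \<times> real) set" where
  "fe_domain X Y = {fe_lo X..fe_hi X} \<times> {fe_lo Y..fe_hi Y}"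

definition basis_vec :: "fe1d \<Rightarrow> real \<Rightarrow> real Matrix.vec" where
  "basis_vec X x = Matrix.vec (npts X) (\<lambda>i. fe_basis X i x)"

definition fe_fun :: "fe1d \<Rightarrow> fe1d \<Rightarrow> real mat \<Rightarrow> real \<times> real \<Rightarrow> real" where
  "fe_fun X Y W = (\<lambda>(x, y). scalar_prod (basis_vec X x) (W *\<^sub>v basis_vec Y y))"

definition coeff_mat :: "fe1d \<Rightarrow> fe1d \<Rightarrow> (real \<times> real \<Rightarrow> real) \<Rightarrow> real mat" where
  "coeff_mat X Y w = (THE W. W \<in> carrier_mat (npts X) (npts Y) \<and>
     (\<forall>z\<in>fe_domain X Y. w z = fe_fun X Y W z))"

definition ip_h :: "fe1d \<Rightarrow> fe1d \<Rightarrow> (real \<times> real \<Rightarrow> real) \<Rightarrow> (real \<times> real \<Rightarrow> real) \<Rightarrow> real" where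
  "ip_h X Y f g = quad1 X (\<lambda>e x. quad1 Y (\<lambda>e' y. f (x, y) * g (x, y)))"

definition heat_op ::
  "fe1d \<Rightarrow> fe1d \<Rightarrow> real \<Rightarrow> (real \<times> real \<Rightarrow> real) \<Rightarrow> real \<times> real \<Rightarrow> real" where
  "heat_op X Y s w = fe_fun X Y
     (mat_exp (s \<cdot>\<^sub>m discrete_laplacian X) * coeff_mat X Y w *
      mat_exp (s \<cdot>\<^sub>m transpose_mat (discrete_laplacian Y)))"

text \<open>The space \<open>{\<Phi>\<^sup>T U S V\<^sup>T \<Psi>}\<close>, with \<open>S\<close> ranging over all matrices of matching size.\<close>

definition lowrank_space ::
  "fe1d \<Rightarrow> fe1d \<Rightarrow> real mat \<Rightarrow> real mat \<Rightarrow> (real \<times> real \<Rightarrow> real) set" where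
  "lowrank_space X Y U V =
     {fe_fun X Y (U * S * transpose_mat V) | S. S \<in> carrier_mat (dim_col U) (dim_col V)}"


section \<open>Nonlinearity\<close>

definition ip_F :: "real mat \<Rightarrow> real mat \<Rightarrow> real" where
  "ip_F A B = mat_trace (transpose_mat A * B)"

definition ip_M :: "fe1d \<Rightarrow> fe1d \<Rightarrow> real mat \<Rightarrow> real mat \<Rightarrow> real" where
  "ip_M X Y A B = ip_F (mass X * A * mass Y) B"

definition all_ones :: "fe1d \<Rightarrow> fe1d \<Rightarrow> real mat" where
  "all_ones X Y = ones_mat (npts X) (npts Y)"

definition area :: "fe1d \<Rightarrow> fe1d \<Rightarrow> real" where
  "area X Y = (fe_hi X - fe_lo X) * (fe_hi Y - fe_lo Y)"

datatype nonlinearity = Classical | RSLM | BBLM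

fun nonlin :: "fe1d \<Rightarrow> fe1d \<Rightarrow> nonlinearity \<Rightarrow> real mat \<Rightarrow> real mat" where
  "nonlin X Y Classical W = W - hadamard_pow W 3"
| "nonlin X Y RSLM W = W - hadamard_pow W 3
     - (1 / area X Y * ip_M X Y (W - hadamard_pow W 3) (all_ones X Y)) \<cdot>\<^sub>m all_ones X Y"
| "nonlin X Y BBLM W = W - hadamard_pow W 3
     - (ip_M X Y (W - hadamard_pow W 3) (all_ones X Y)
        / ip_M X Y (all_ones X Y - hadamard_pow W 2) (all_ones X Y))
       \<cdot>\<^sub>m (all_ones X Y - hadamard_pow W 2)"

text \<open>Division is total; the condition excludes the meaningless case of a vanishing BBLM denominator.\<close>

definition nonlin_defined :: "fe1d \<Rightarrow> fe1d \<Rightarrow> nonlinearity \<Rightarrow> real mat \<Rightarrow> bool" where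
  "nonlin_defined X Y nl W \<longleftrightarrow>
     (nl = BBLM \<longrightarrow> ip_M X Y (all_ones X Y - hadamard_pow W 2) (all_ones X Y) \<noteq> 0)"

definition nonlin_fun ::
  "fe1d \<Rightarrow> fe1d \<Rightarrow> nonlinearity \<Rightarrow> (real \<times> real \<Rightarrow> real) \<Rightarrow> real \<times> real \<Rightarrow> real" where
  "nonlin_fun X Y nl w = fe_fun X Y (nonlin X Y nl (coeff_mat X Y w))"


section \<open>Steps of the algorithm\<close>

text \<open>Each step is the relation between its input and an admissible output. The matrices
  \<open>U\<close>, \<open>V\<close> keep the number \<open>r\<close> of columns in the linear step.\<close>

definition linear_bases ::
  "fe1d \<Rightarrow> fe1d \<Rightarrow> real \<Rightarrow> real mat \<Rightarrow> real mat \<Rightarrow> real mat \<Rightarrow> real mat \<Rightarrow> real mat \<Rightarrow> real mat \<Rightarrow> bool"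
  where
  "linear_bases X Y s U V U1 R V1 P \<longleftrightarrow>
     gqr (mat_exp (s \<cdot>\<^sub>m discrete_laplacian X) * U) (mass X) U1 R \<and> dim_col U1 = dim_col U \<and>
     gqr (mat_exp (s \<cdot>\<^sub>m discrete_laplacian Y) * V) (mass Y) V1 P \<and> dim_col V1 = dim_col V"

definition bug_step ::
  "fe1d \<Rightarrow> fe1d \<Rightarrow> nonlinearity \<Rightarrow> real \<Rightarrow> real mat \<Rightarrow> real mat \<Rightarrow> real mat \<Rightarrow>
   real mat \<Rightarrow> real mat \<Rightarrow> real mat \<Rightarrow> bool" where
  "bug_step X Y nl \<tau> U1 S1 V1 U2 S2 V2 \<longleftrightarrow>
     (let W1 = U1 * S1 * transpose_mat V1;
          K = U1 * S1 + \<tau> \<cdot>\<^sub>m (nonlin X Y nl W1 * mass Y * V1);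
          L = V1 * transpose_mat S1 + \<tau> \<cdot>\<^sub>m (transpose_mat (nonlin X Y nl W1) * mass X * U1);
          S' = (transpose_mat U2 * mass X * U1) * S1 * transpose_mat (transpose_mat V2 * mass Y * V1);
          W' = U2 * S' * transpose_mat V2
      in nonlin_defined X Y nl W1 \<and> nonlin_defined X Y nl W' \<and>
         (\<exists>R. gqr (mat_of_cols (npts X) (cols K @ cols U1)) (mass X) U2 R) \<and>
         (\<exists>P. gqr (mat_of_cols (npts Y) (cols L @ cols V1)) (mass Y) V2 P) \<and>
         S2 = S' + \<tau> \<cdot>\<^sub>m (transpose_mat U2 * mass X * nonlin X Y nl W' * mass Y * V2))"

definition galerkin_bases ::
  "fe1d \<Rightarrow> fe1d \<Rightarrow> nonlinearity \<Rightarrow> real \<Rightarrow> real mat \<Rightarrow> real mat \<Rightarrow> real mat \<Rightarrow>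
   real mat \<Rightarrow> real mat \<Rightarrow> real mat \<Rightarrow> real mat \<Rightarrow> real mat \<Rightarrow> bool" where
  "galerkin_bases X Y nl \<tau> U1 S1 V1 U2 S2 V2 Ub Vb \<longleftrightarrow>
     (let N1 = nonlin X Y nl (U1 * S1 * transpose_mat V1);
          N2 = nonlin X Y nl (U2 * S2 * transpose_mat V2);
          UU = mat_of_cols (npts X) (Matrix.vec (npts X) (\<lambda>_. 1) # cols U1 @
                 cols (\<tau> \<cdot>\<^sub>m (N1 * V1)) @ cols (\<tau> \<cdot>\<^sub>m (N2 * V2)));
          VV = mat_of_cols (npts Y) (Matrix.vec (npts Y) (\<lambda>_. 1) # cols V1 @
                 cols (\<tau> \<cdot>\<^sub>m (transpose_mat N1 * U1)) @ cols (\<tau> \<cdot>\<^sub>m (transpose_mat N2 * U2)))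
      in nonlin_defined X Y nl (U1 * S1 * transpose_mat V1) \<and>
         nonlin_defined X Y nl (U2 * S2 * transpose_mat V2) \<and>
         (\<exists>R. gqr UU (mass X) Ub R) \<and> (\<exists>P. gqr VV (mass Y) Vb P) \<and> dim_col Vb = dim_col Ub)"

definition truncation ::
  "real \<Rightarrow> nat \<Rightarrow> real mat \<Rightarrow> real mat \<Rightarrow> real mat \<Rightarrow> real mat \<Rightarrow> real mat \<Rightarrow> real mat \<Rightarrow> bool" where
  "truncation \<eta> q Ub Sb Vb U S V \<longleftrightarrow>
     (\<exists>R \<sigma> P. is_svd Sb R \<sigma> P \<and> q \<le> dim_row Sb \<and>
        sqrt (\<Sum>i\<in>{q..<dim_row Sb}. (\<sigma> i)\<^sup>2) \<le> \<eta> \<and>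
        S = mat_diag q \<sigma> \<and> U = Ub * first_cols q R \<and> V = Vb * first_cols q P)"

end

theory Submission
  imports Defs
begin

text \<open>Everything is transported from functions to coefficient matrices, where the algorithm lives.
  Two facts make the transport faithful: a finite element function on the domain determines its
  coefficients, because the nodes lie in the domain (\<open>fe_fun_eq_on_domain_iff\<close>), and the discrete
  inner product of two such functions is the mass-weighted Frobenius product of their coefficients
  (\<open>ip_h_fe_fun\<close>).

  A linear step then asks for \<open>U1 T V1\<^sup>T = (e\<^bsup>s Lx\<^esup> U) S (e\<^bsup>s Ly\<^esup> V)\<^sup>T\<close>. The right-hand side
  is \<open>U1 (R S P\<^sup>T) V1\<^sup>T\<close> by the two factorizations, and since \<open>U1\<close> and \<open>V1\<close> are orthonormal for
  the mass matrices, \<open>T\<close> can only be \<open>R S P\<^sup>T\<close> (\<open>linear_step_iff\<close>).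

  In a Galerkin relation, testing a function with coefficients \<open>Z\<close> against
  \<open>\<Phi>\<^sup>T Ub T Vb\<^sup>T \<Psi>\<close> gives the Frobenius product of \<open>Ub\<^sup>T M\<^sub>x Z M\<^sub>y Vb\<close> with \<open>T\<close>
  (\<open>ip_h_lowrank_test\<close>). As \<open>T\<close> is arbitrary, the relation for all test functions is an equation
  between \<open>rb \<times> rb\<close> matrices. It is the update of the algorithm, provided that projecting
  the state after the linear step onto the augmented bases loses nothing: the nonlinearity is
  evaluated at the projected state in the algorithm and at the unprojected one in the finite
  element scheme. The two states coincide because the columns of \<open>U1\<close> and \<open>V1\<close> lie in the
  column spaces of \<open>Ub\<close> and \<open>Vb\<close> (\<open>gqr_project_block\<close>). The truncation is common to both sides
  and hands the same factors to the last linear step.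

  One analytic ingredient remains. The discrete Laplacians, and with them their exponentials, are
  meaningful once the mass matrices are known to be invertible. They are diagonal because the
  basis is nodal, with positive entries because the Gauss--Lobatto weights are positive.\<close>


section \<open>Matrix products and the Frobenius inner product\<close>

text \<open>Stated with dimensions as side conditions, associativity and transposition of products can be
  used by the simplifier without guessing the sizes of intermediate factors.\<close>

lemma mult_mat_assoc:
  fixes A B C :: "real mat"
  assumes "dim_col A = dim_row B" "dim_col B = dim_row C"
  shows "A * B * C = A * (B * C)"
  by (rule assoc_mult_mat[of _ "dim_row A" "dim_col A" _ "dim_col B" _ "dim_col C"]) (use assms in auto)

lemma transpose_mult_mat:
  fixes A B :: "real mat"
  assumes "dim_col A = dim_row B"
  shows "transpose_mat (A * B) = transpose_mat B * transpose_mat A"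
  by (rule transpose_mult[of _ "dim_row A" "dim_col A" _ "dim_col B"]) (use assms in auto)

lemma mat_trace_mult_commute:
  assumes A: "A \<in> carrier_mat p q" and B: "B \<in> carrier_mat q p"
  shows "mat_trace (A * B) = mat_trace (B * A)"
proof -
  have "mat_trace (A * B) = (\<Sum>i<p. \<Sum>j<q. A $$ (i, j) * B $$ (j, i))"
    using A B by (simp add: mat_trace_def scalar_prod_def atLeast0LessThan)
  also have "\<dots> = (\<Sum>j<q. \<Sum>i<p. B $$ (j, i) * A $$ (i, j))"
    by (subst sum.swap) (simp add: mult.commute)
  also have "\<dots> = mat_trace (B * A)"
    using A B by (simp add: mat_trace_def scalar_prod_def atLeast0LessThan)
  finally show ?thesis .
qed

lemma ip_F_eq_sum:
  assumes A: "A \<in> carrier_mat p q" and B: "B \<in> carrier_mat p q"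
  shows "ip_F A B = (\<Sum>j<q. \<Sum>i<p. A $$ (i, j) * B $$ (i, j))"
  using A B by (simp add: ip_F_def mat_trace_def scalar_prod_def atLeast0LessThan)

lemma ip_F_add_left:
  assumes "A \<in> carrier_mat p q" "B \<in> carrier_mat p q" "T \<in> carrier_mat p q"
  shows "ip_F (A + B) T = ip_F A T + ip_F B T"
  using assms by (simp add: ip_F_eq_sum[where p = p and q = q] sum.distrib algebra_simps)

lemma ip_F_smult_left:
  assumes "A \<in> carrier_mat p q" "T \<in> carrier_mat p q"
  shows "ip_F (c \<cdot>\<^sub>m A) T = c * ip_F A T"
  using assms by (simp add: ip_F_eq_sum[where p = p and q = q] sum_distrib_left algebra_simps)

lemma sum_double_delta:
  fixes f :: "nat \<Rightarrow> nat \<Rightarrow> real"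
  assumes "i < p" "j < q"
  shows "(\<Sum>k<p. \<Sum>l<q. if k = i then if l = j then f k l else 0 else 0) = f i j"
proof -
  have "(\<Sum>k<p. \<Sum>l<q. if k = i then if l = j then f k l else 0 else 0) =
      (\<Sum>k<p. if k = i then (\<Sum>l<q. if l = j then f k l else 0) else 0)"
    by (intro sum.cong) auto
  then show ?thesis using assms by simp
qed

lemma ip_F_nondegenerate:
  assumes A: "A \<in> carrier_mat p q" and B: "B \<in> carrier_mat p q"
  shows "(\<forall>T \<in> carrier_mat p q. ip_F A T = ip_F B T) \<longleftrightarrow> A = B"
proof
  assume eq: "\<forall>T \<in> carrier_mat p q. ip_F A T = ip_F B T"
  show "A = B"
  proof (rule eq_matI)
    fix i j assume ij: "i < dim_row B" "j < dim_col B"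
    \<comment> \<open>testing against the matrix unit at \<open>(i, j)\<close> reads off the entry\<close>
    define T :: "real mat" where
      "T = Matrix.mat p q (\<lambda>(k, l). if l = j then if k = i then 1 else 0 else 0)"
    have T: "T \<in> carrier_mat p q" by (simp add: T_def)
    have read: "ip_F C T = C $$ (i, j)" if "C \<in> carrier_mat p q" for C
    proof -
      have "ip_F C T = (\<Sum>l<q. \<Sum>k<p. if l = j then if k = i then C $$ (k, l) else 0 else 0)"
        unfolding ip_F_eq_sum[OF that T] by (intro sum.cong refl) (simp add: T_def)
      also have "\<dots> = C $$ (i, j)"
        by (rule sum_double_delta) (use ij B in auto)
      finally show ?thesis .
    qed
    from T show "A $$ (i, j) = B $$ (i, j)"
      using eq read[OF A] read[OF B] by auto
  qed (use A B in auto)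
qed simp

text \<open>Cyclicity of the trace moves the bases from the test matrix to the other argument.\<close>

lemma ip_F_sandwich_right:
  assumes A: "A \<in> carrier_mat m n" and U: "U \<in> carrier_mat m p" and V: "V \<in> carrier_mat n q"
    and T: "T \<in> carrier_mat p q"
  shows "ip_F A (U * T * transpose_mat V) = ip_F (transpose_mat U * A * V) T"
proof -
  have "ip_F A (U * T * transpose_mat V) = mat_trace ((transpose_mat A * U * T) * transpose_mat V)"
    using assms by (simp add: ip_F_def mult_mat_assoc del: assoc_mult_mat)
  also have "\<dots> = mat_trace (transpose_mat V * (transpose_mat A * U * T))"
    by (rule mat_trace_mult_commute[of _ n q]) (use assms in auto)
  also have "\<dots> = ip_F (transpose_mat U * A * V) T"
    using assms by (simp add: ip_F_def mult_mat_assoc transpose_mult_mat del: assoc_mult_mat)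
  finally show ?thesis .
qed


section \<open>Coefficients and quadrature of finite element functions\<close>

lemma fe_fun_eq_sum:
  assumes "W \<in> carrier_mat (npts X) (npts Y)"
  shows "fe_fun X Y W (x, y) =
    (\<Sum>i<npts X. \<Sum>j<npts Y. W $$ (i, j) * (fe_basis X i x * fe_basis Y j y))"
  using assms by (simp add: fe_fun_def basis_vec_def scalar_prod_def atLeast0LessThan
      sum_distrib_left algebra_simps)

text \<open>A node is \<open>lo + (e + (1 + \<xi>\<^sub>p) / 2) h\<close>, so the claim is that the factor of \<open>h\<close> lies
  between \<open>0\<close> and the number of cells. The last node has cell index \<open>e\<close> equal to
  that number, one past the last cell, but then its local index \<open>p\<close> is \<open>0\<close> and \<open>\<xi>\<^sub>0 = -1\<close>.\<close>

lemma node_in_domain: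
  assumes fe: "fe_discretization X" and i: "i < npts X"
  shows "node X i \<in> {fe_lo X..fe_hi X}"
proof -
  define k where "k = fe_deg X"
  define e where "e = i div k"
  define p where "p = i mod k"
  have k: "k \<ge> 1" and M: "fe_cells X \<ge> 1" and lh: "fe_lo X < fe_hi X"
    and gl: "gauss_lobatto k (ref_node X) (ref_weight X)"
    using fe by (auto simp: fe_discretization_def k_def)
  have p: "p < k" using k by (simp add: p_def)
  have mono: "strict_mono_on {0..k} (ref_node X)" and x0: "ref_node X 0 = -1" and xk: "ref_node X k = 1"
    using gl by (auto simp: gauss_lobatto_def)
  have lo: "-1 \<le> ref_node X p"
    using strict_mono_onD[OF mono, of 0 p] p x0 by (cases "p = 0") auto
  have hi: "ref_node X p < 1"
    using strict_mono_onD[OF mono, of p k] p xk by auto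
  have ieq: "i = e * k + p" by (simp add: e_def p_def)
  have iM: "i \<le> fe_cells X * k" using i by (simp add: npts_def k_def)
  have h: "mesh_width X > 0" using lh M by (simp add: mesh_width_def)
  have hM: "fe_hi X = fe_lo X + real (fe_cells X) * mesh_width X"
    using M by (simp add: mesh_width_def)
  have pos: "real e + (1 + ref_node X p) / 2 \<le> real (fe_cells X)"
  proof (cases "e < fe_cells X")
    case True
    then have "real e + 1 \<le> real (fe_cells X)" by simp
    then show ?thesis using hi by (simp add: field_simps)
  next
    case False
    then have "fe_cells X * k \<le> e * k" by simp
    then have "p = 0" and "e * k = fe_cells X * k" using ieq iM by linarith+
    then show ?thesis using k x0 by simp
  qed
  have "node X i = fe_lo X + (real e + (1 + ref_node X p) / 2) * mesh_width X"
    by (simp add: node_def cell_point_def e_def p_def k_def algebra_simps)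
  moreover have "0 \<le> (real e + (1 + ref_node X p) / 2) * mesh_width X"
    using lo h by simp
  moreover have "(real e + (1 + ref_node X p) / 2) * mesh_width X \<le> real (fe_cells X) * mesh_width X"
    using pos h by (intro mult_right_mono) auto
  ultimately show ?thesis using hM by simp
qed

lemma fe_fun_at_nodes:
  assumes X: "fe_discretization X" and Y: "fe_discretization Y"
    and W: "W \<in> carrier_mat (npts X) (npts Y)" and i: "i < npts X" and j: "j < npts Y"
  shows "fe_fun X Y W (node X i, node Y j) = W $$ (i, j)"
proof -
  have "fe_basis X k (node X i) = (if k = i then 1 else 0)" if "k < npts X" for k
    using X i that by (simp add: fe_discretization_def)
  moreover have "fe_basis Y l (node Y j) = (if l = j then 1 else 0)" if "l < npts Y" for l
    using Y j that by (simp add: fe_discretization_def)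
  ultimately have "fe_fun X Y W (node X i, node Y j) =
      (\<Sum>k<npts X. \<Sum>l<npts Y. if k = i then if l = j then W $$ (k, l) else 0 else 0)"
    unfolding fe_fun_eq_sum[OF W] by (intro sum.cong refl) simp
  also have "\<dots> = W $$ (i, j)" by (rule sum_double_delta) (use i j in auto)
  finally show ?thesis .
qed

text \<open>Evaluation at the nodes reads off the coefficients.\<close>

lemma fe_fun_eq_on_domain_iff:
  assumes X: "fe_discretization X" and Y: "fe_discretization Y"
    and A: "A \<in> carrier_mat (npts X) (npts Y)" and B: "B \<in> carrier_mat (npts X) (npts Y)"
  shows "(\<forall>z\<in>fe_domain X Y. fe_fun X Y A z = fe_fun X Y B z) \<longleftrightarrow> A = B"
proof
  assume eq: "\<forall>z\<in>fe_domain X Y. fe_fun X Y A z = fe_fun X Y B z"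
  show "A = B"
  proof (rule eq_matI)
    fix i j assume "i < dim_row B" "j < dim_col B"
    then have ij: "i < npts X" "j < npts Y" using B by auto
    have "(node X i, node Y j) \<in> fe_domain X Y"
      using node_in_domain[OF X ij(1)] node_in_domain[OF Y ij(2)] by (simp add: fe_domain_def)
    then have "fe_fun X Y A (node X i, node Y j) = fe_fun X Y B (node X i, node Y j)"
      using eq by blast
    then show "A $$ (i, j) = B $$ (i, j)"
      by (simp add: fe_fun_at_nodes[OF X Y A ij] fe_fun_at_nodes[OF X Y B ij])
  qed (use A B in auto)
qed simp

lemma coeff_mat_fe_fun:
  assumes "fe_discretization X" "fe_discretization Y" "W \<in> carrier_mat (npts X) (npts Y)"
  shows "coeff_mat X Y (fe_fun X Y W) = W"
  unfolding coeff_mat_def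
  by (rule the_equality) (use assms fe_fun_eq_on_domain_iff[of X Y W] in auto)

lemma quad1_sum: "quad1 X (\<lambda>e x. \<Sum>i\<in>I. g i e x) = (\<Sum>i\<in>I. quad1 X (g i))"
proof -
  have "quad1 X (\<lambda>e x. \<Sum>i\<in>I. g i e x) = (\<Sum>e<fe_cells X. \<Sum>i\<in>I. \<Sum>p\<le>fe_deg X.
      mesh_width X / 2 * ref_weight X p * g i e (cell_point X e p))"
    unfolding quad1_def sum_distrib_left by (intro sum.cong refl) (rule sum.swap)
  also have "\<dots> = (\<Sum>i\<in>I. quad1 X (g i))"
    unfolding quad1_def by (rule sum.swap)
  finally show ?thesis .
qed

lemma quad1_cmult: "quad1 X (\<lambda>e x. c * g e x) = c * quad1 X g"
  by (simp add: quad1_def sum_distrib_left algebra_simps)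

lemma mass_carrier [simp]: "mass X \<in> carrier_mat (npts X) (npts X)"
  by (simp add: mass_def)

lemma mass_dim [simp]: "dim_row (mass X) = npts X" "dim_col (mass X) = npts X"
  by (simp_all add: mass_def)

text \<open>Both sides are bilinear, and the quadrature of a product \<open>\<phi>\<^sub>i \<phi>\<^sub>k \<psi>\<^sub>j \<psi>\<^sub>l\<close> factors
  into an entry of each mass matrix.\<close>

lemma ip_h_fe_fun:
  assumes A: "A \<in> carrier_mat (npts X) (npts Y)" and B: "B \<in> carrier_mat (npts X) (npts Y)"
  shows "ip_h X Y (fe_fun X Y A) (fe_fun X Y B) = ip_M X Y A B"
proof -
  let ?m = "npts X" and ?n = "npts Y"
  let ?\<phi> = "fe_basis X" and ?\<psi> = "fe_basis Y"
  have MX: "quad1 X (\<lambda>e x. ?\<phi> i x * ?\<phi> k x) = mass X $$ (k, i)" if "i < ?m" "k < ?m" for i k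
    using that by (simp add: mass_def mult.commute)
  have MY: "quad1 Y (\<lambda>e y. ?\<psi> j y * ?\<psi> l y) = mass Y $$ (j, l)" if "j < ?n" "l < ?n" for j l
    using that by (simp add: mass_def)
  have prod: "fe_fun X Y A (x, y) * fe_fun X Y B (x, y) =
      (\<Sum>i<?m. \<Sum>k<?m. \<Sum>j<?n. \<Sum>l<?n.
         (A $$ (i, j) * B $$ (k, l) * (?\<phi> i x * ?\<phi> k x)) * (?\<psi> j y * ?\<psi> l y))" for x y
    unfolding fe_fun_eq_sum[OF A] fe_fun_eq_sum[OF B] sum_product
    by (intro sum.cong refl) (simp add: algebra_simps)
  have inner: "quad1 Y (\<lambda>e y. fe_fun X Y A (x, y) * fe_fun X Y B (x, y)) =
      (\<Sum>i<?m. \<Sum>k<?m. \<Sum>j<?n. \<Sum>l<?n.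
         (A $$ (i, j) * B $$ (k, l) * mass Y $$ (j, l)) * (?\<phi> i x * ?\<phi> k x))" for x
    unfolding prod quad1_sum quad1_cmult by (intro sum.cong refl) (simp add: MY)
  have "ip_h X Y (fe_fun X Y A) (fe_fun X Y B) =
      (\<Sum>i<?m. \<Sum>k<?m. \<Sum>j<?n. \<Sum>l<?n.
         A $$ (i, j) * B $$ (k, l) * mass Y $$ (j, l) * mass X $$ (k, i))"
    unfolding ip_h_def inner quad1_sum quad1_cmult by (intro sum.cong refl) (simp add: MX)
  also have "\<dots> = (\<Sum>k<?m. \<Sum>l<?n. \<Sum>j<?n. \<Sum>i<?m.
         A $$ (i, j) * B $$ (k, l) * mass Y $$ (j, l) * mass X $$ (k, i))"
    (is "?lhs = ?rhs")
  proof -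
    let ?f = "\<lambda>i k j l. A $$ (i, j) * B $$ (k, l) * mass Y $$ (j, l) * mass X $$ (k, i)"
    have "?lhs = (\<Sum>k<?m. \<Sum>i<?m. \<Sum>j<?n. \<Sum>l<?n. ?f i k j l)" by (rule sum.swap)
    also have "\<dots> = (\<Sum>k<?m. \<Sum>j<?n. \<Sum>i<?m. \<Sum>l<?n. ?f i k j l)"
      by (rule sum.cong[OF refl], rule sum.swap)
    also have "\<dots> = (\<Sum>k<?m. \<Sum>j<?n. \<Sum>l<?n. \<Sum>i<?m. ?f i k j l)"
      by (rule sum.cong[OF refl], rule sum.cong[OF refl], rule sum.swap)
    also have "\<dots> = (\<Sum>k<?m. \<Sum>l<?n. \<Sum>j<?n. \<Sum>i<?m. ?f i k j l)"
      by (rule sum.cong[OF refl], rule sum.swap)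
    finally show ?thesis .
  qed
  also have "\<dots> = (\<Sum>l<?n. \<Sum>k<?m. (mass X * A * mass Y) $$ (k, l) * B $$ (k, l))"
    using A by (subst sum.swap)
      (simp add: scalar_prod_def atLeast0LessThan sum_distrib_left sum_distrib_right algebra_simps
        del: assoc_mult_mat)
  also have "\<dots> = ip_M X Y A B"
    unfolding ip_M_def by (rule ip_F_eq_sum[symmetric]) (use A B in auto)
  finally show ?thesis .
qed


section \<open>Invertibility of the mass matrix\<close>

text \<open>The rule is applied to a polynomial that is nonnegative on \<open>[-1, 1]\<close> and vanishes at every node
  except the \<open>j\<close>-th. An interior node needs a double root to avoid a sign change, whereas an endpoint
  needs only a simple one. All \<open>k + 1\<close> factors together have degree \<open>2 + 2 (k - 1) = 2 k\<close>, so leaving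
  out the \<open>j\<close>-th one gives degree at most \<open>2 k - 1\<close>, which the rule still integrates exactly.\<close>

lemma gauss_lobatto_weight_pos:
  assumes gl: "gauss_lobatto k \<xi> \<omega>" and k: "1 \<le> k" and j: "j \<le> k"
  shows "\<omega> j > 0"
proof -
  define f :: "nat \<Rightarrow> real poly" where
    "f i = (if i = 0 then [:1, 1:] else if i = k then [:1, -1:] else [:- \<xi> i, 1:] ^ 2)" for i
  define p where "p = (\<Prod>i\<in>{..k} - {j}. f i)"
  have x0: "\<xi> 0 = -1" and xk: "\<xi> k = 1" and mono: "strict_mono_on {0..k} \<xi>"
    and exact: "\<And>p :: real poly. degree p \<le> 2 * k - 1 \<Longrightarrow>
      integral {-1..1} (poly p) = (\<Sum>j\<le>k. \<omega> j * poly p (\<xi> j))"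
    using gl by (auto simp: gauss_lobatto_def)
  have inj: "\<xi> i \<noteq> \<xi> l" if "i \<le> k" "l \<le> k" "i \<noteq> l" for i l
    using strict_mono_on_imp_inj_on[OF mono] that by (auto simp: inj_on_def)
  have range: "-1 \<le> \<xi> i \<and> \<xi> i \<le> 1" if "i \<le> k" for i
    using strict_mono_on_leD[OF mono, of 0 i] strict_mono_on_leD[OF mono, of i k] that x0 xk by auto
  have f_nonneg: "0 \<le> poly (f i) x" if "-1 \<le> x" "x \<le> 1" for i x
    using that by (simp add: f_def)
  have f_zero_iff: "poly (f i) (\<xi> l) = 0 \<longleftrightarrow> i = l" if "i \<le> k" "l \<le> k" for i l
  proof -
    have "\<xi> i = \<xi> l \<longleftrightarrow> i = l" "\<xi> l = -1 \<longleftrightarrow> l = 0" "\<xi> l = 1 \<longleftrightarrow> l = k"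
      using inj[of i l] inj[of l 0] inj[of l k] that x0 xk by auto
    moreover have "poly (f i) (\<xi> l) = 0 \<longleftrightarrow>
        (if i = 0 then \<xi> l = -1 else if i = k then \<xi> l = 1 else \<xi> i = \<xi> l)"
      by (auto simp: f_def)
    ultimately show ?thesis by auto
  qed
  have p_nonneg: "0 \<le> poly p x" if "x \<in> {-1..1}" for x
    unfolding p_def poly_prod by (rule prod_nonneg) (use f_nonneg that in auto)
  have p_pos: "0 < poly p (\<xi> j)"
    unfolding p_def poly_prod
  proof (rule prod_pos)
    fix i assume "i \<in> {..k} - {j}"
    then show "0 < poly (f i) (\<xi> j)"
      using f_nonneg[of "\<xi> j" i] range[OF j] f_zero_iff[of i j] j by fastforce
  qed
  have p_zero: "poly p (\<xi> l) = 0" if "l \<le> k" "l \<noteq> j" for l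
    unfolding p_def poly_prod using that f_zero_iff[of l l] by (intro prod_zero) auto
  have "degree p \<le> 2 * k - 1"
  proof -
    define d :: "nat \<Rightarrow> nat" where "d i = (if i = 0 \<or> i = k then 1 else 2)" for i
    have "(\<Sum>i\<le>k. d i + ((if i = 0 then 1 else 0) + (if i = k then 1 else 0))) = (\<Sum>i\<le>k. 2)"
      using k by (intro sum.cong) (auto simp: d_def)
    then have "(\<Sum>i\<le>k. d i) = 2 * k"
      using k by (simp add: sum.distrib)
    moreover have "(\<Sum>i\<le>k. d i) = d j + (\<Sum>i\<in>{..k} - {j}. d i)"
      using j by (simp add: sum.remove)
    moreover have "d j \<ge> 1" by (simp add: d_def)
    moreover have "degree (f i) \<le> d i" for i
      using degree_power_le[of "[:- \<xi> i, 1:]" 2] by (auto simp: f_def d_def)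
    then have "(\<Sum>i\<in>{..k} - {j}. degree (f i)) \<le> (\<Sum>i\<in>{..k} - {j}. d i)"
      by (intro sum_mono)
    then have "degree p \<le> (\<Sum>i\<in>{..k} - {j}. d i)"
      using degree_prod_sum_le[of "{..k} - {j}" f] by (simp add: p_def comp_def)
    ultimately show ?thesis by linarith
  qed
  then have "integral {-1..1} (poly p) = (\<Sum>l\<le>k. \<omega> l * poly p (\<xi> l))"
    by (rule exact)
  also have "\<dots> = (\<Sum>l\<le>k. if l = j then \<omega> j * poly p (\<xi> j) else 0)"
    by (intro sum.cong) (auto simp: p_zero)
  also have "\<dots> = \<omega> j * poly p (\<xi> j)" using j by simp
  finally have int: "integral {-1..1} (poly p) = \<omega> j * poly p (\<xi> j)" .
  have cont: "continuous_on {-1..1} (poly p)" by (intro continuous_intros)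
  have "integral {-1..1} (poly p) \<ge> 0"
    by (rule integral_nonneg) (use cont p_nonneg integrable_continuous_real in auto)
  moreover have "integral {-1..1} (poly p) \<noteq> 0"
    using integral_eq_0_iff[OF cont] p_nonneg p_pos range[OF j] by force
  ultimately have "0 < \<omega> j * poly p (\<xi> j)" using int by linarith
  then show ?thesis using p_pos by (simp add: zero_less_mult_iff)
qed

text \<open>For \<open>p = k\<close> the right end of a cell is recognized as the left end of the next cell.\<close>

lemma cell_point_eq_node:
  assumes fe: "fe_discretization X" and p: "p \<le> fe_deg X"
  shows "cell_point X e p = node X (e * fe_deg X + p)"
proof (cases "p = fe_deg X")
  case True
  have "ref_node X (fe_deg X) = 1" "ref_node X 0 = -1" "fe_deg X \<noteq> 0"
    using fe by (auto simp: fe_discretization_def gauss_lobatto_def)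
  moreover from this have "(e * fe_deg X + fe_deg X) div fe_deg X = e + 1" by simp
  ultimately show ?thesis
    using True by (simp add: node_def cell_point_def algebra_simps)
next
  case False
  then show ?thesis using p by (simp add: node_def)
qed

lemma mass_entry:
  assumes fe: "fe_discretization X" and i: "i < npts X" and j: "j < npts X"
  shows "mass X $$ (i, j) = (\<Sum>e<fe_cells X. \<Sum>p\<le>fe_deg X.
    if i = e * fe_deg X + p \<and> j = e * fe_deg X + p then mesh_width X / 2 * ref_weight X p else 0)"
proof -
  have "e * fe_deg X + p < npts X" if "e < fe_cells X" "p \<le> fe_deg X" for e p
  proof -
    have "e * fe_deg X + p \<le> (e + 1) * fe_deg X" using that by simp
    also have "\<dots> \<le> fe_cells X * fe_deg X" using that by (intro mult_right_mono) auto
    finally show ?thesis by (simp add: npts_def)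
  qed
  moreover have "fe_basis X i (node X l) = (if i = l then 1 else 0)" if "i < npts X" "l < npts X" for i l
    using fe that by (simp add: fe_discretization_def)
  ultimately show ?thesis
    using i j by (auto simp: mass_def quad1_def cell_point_eq_node[OF fe] intro!: sum.cong)
qed

lemma mass_diagonal:
  assumes fe: "fe_discretization X" and i: "i < npts X" and j: "j < npts X" and "i \<noteq> j"
  shows "mass X $$ (i, j) = 0"
  unfolding mass_entry[OF fe i j] using assms by (intro sum.neutral ballI) auto

lemma mass_diagonal_pos:
  assumes fe: "fe_discretization X" and i: "i < npts X"
  shows "mass X $$ (i, i) > 0"
proof -
  let ?k = "fe_deg X"
  let ?g = "\<lambda>e p. if i = e * ?k + p then mesh_width X / 2 * ref_weight X p else 0"
  have k: "1 \<le> ?k" and M: "1 \<le> fe_cells X" and h: "mesh_width X > 0"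
    and gl: "gauss_lobatto ?k (ref_node X) (ref_weight X)"
    using fe by (auto simp: fe_discretization_def mesh_width_def)
  have wpos: "ref_weight X p > 0" if "p \<le> ?k" for p
    by (rule gauss_lobatto_weight_pos[OF gl k that])
  have g_nonneg: "0 \<le> ?g e p" if "p \<le> ?k" for e p
    using wpos[OF that] h by simp
  \<comment> \<open>the last node has no cell to its right, so it is taken as the right end of the last cell\<close>
  obtain e p where ep: "e < fe_cells X" "p \<le> ?k" "i = e * ?k + p"
  proof (cases "i div ?k < fe_cells X")
    case True
    then show ?thesis using that[of "i div ?k" "i mod ?k"] k by (simp add: less_imp_le)
  next
    case False
    then have "fe_cells X * ?k \<le> i"
      by (metis div_mult_mod_eq le_add1 le_trans linorder_not_less mult_le_mono1)
    then have "i = fe_cells X * ?k" using i by (simp add: npts_def)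
    also have "\<dots> = (fe_cells X - 1) * ?k + ?k"
      using M by (simp add: algebra_simps)
    finally show ?thesis using that[of "fe_cells X - 1" ?k] M by simp
  qed
  have "0 < ?g e p" using ep wpos h by simp
  also have "\<dots> \<le> (\<Sum>p\<le>?k. ?g e p)"
    by (rule member_le_sum) (use ep g_nonneg in auto)
  also have "\<dots> \<le> (\<Sum>e<fe_cells X. \<Sum>p\<le>?k. ?g e p)"
    by (rule member_le_sum[of e _ "\<lambda>e. \<Sum>p\<le>?k. ?g e p"]) (use ep g_nonneg in \<open>auto intro!: sum_nonneg\<close>)
  also have "\<dots> = mass X $$ (i, i)" by (simp add: mass_entry[OF fe i i])
  finally show ?thesis .
qed

text \<open>The inverse is defined through a partial function, so even its size is known only once the mass
  matrix is shown to be invertible.\<close>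

lemma mat_inv_mass_carrier:
  assumes fe: "fe_discretization X"
  shows "mat_inv (mass X) \<in> carrier_mat (npts X) (npts X)"
proof -
  let ?n = "npts X"
  let ?d = "\<lambda>i. mass X $$ (i, i)"
  have M: "mass X = mat_diag ?n ?d"
    by (rule eq_matI) (auto simp: mat_diag_def mass_diagonal[OF fe])
  have one: "mat_diag ?n (\<lambda>i. ?d i * (1 / ?d i)) = 1\<^sub>m ?n" "mat_diag ?n (\<lambda>i. (1 / ?d i) * ?d i) = 1\<^sub>m ?n"
    using mass_diagonal_pos[OF fe] by (auto simp: mat_diag_def less_imp_neq[symmetric] intro!: eq_matI)
  have "mass X * mat_diag ?n (\<lambda>i. 1 / ?d i) = 1\<^sub>m ?n"
    by (subst M) (simp only: mat_diag_diag one)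
  moreover have "mat_diag ?n (\<lambda>i. 1 / ?d i) * mass X = 1\<^sub>m ?n"
    by (subst (2) M) (simp only: mat_diag_diag one)
  ultimately have "mass X \<in> Units (ring_mat TYPE(real) ?n ())"
    by (auto simp: Units_def ring_mat_def intro!: bexI[of _ "mat_diag ?n (\<lambda>i. 1 / ?d i)"])
  then obtain B where "mat_inverse (mass X) = Some B"
    using mat_inverse(1)[OF mass_carrier[of X], where b = "()"] by (cases "mat_inverse (mass X)") auto
  then show ?thesis
    using mat_inverse(2)[OF mass_carrier] by (simp add: mat_inv_def)
qed

lemma discrete_laplacian_carrier:
  assumes "fe_discretization X"
  shows "discrete_laplacian X \<in> carrier_mat (npts X) (npts X)"
proof -
  have "stiffness X \<in> carrier_mat (npts X) (npts X)" by (simp add: stiffness_def)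
  then show ?thesis using mat_inv_mass_carrier[OF assms] by (simp add: discrete_laplacian_def)
qed


section \<open>Bases orthonormal for a mass matrix\<close>

lemma gqrD:
  assumes "gqr A M Q R" "A \<in> carrier_mat m p" "dim_col Q = q"
  shows "Q \<in> carrier_mat m q" "R \<in> carrier_mat q p" "A = Q * R" "transpose_mat Q * M * Q = 1\<^sub>m q"
  using assms(1)[unfolded gqr_def carrier_matD[OF assms(2)] assms(3)] by blast+

lemma orthonormal_cancel:
  fixes U V M N S :: "real mat"
  assumes U: "U \<in> carrier_mat m p" "transpose_mat U * M * U = 1\<^sub>m p" and M: "M \<in> carrier_mat m m"
    and V: "V \<in> carrier_mat n q" "transpose_mat V * N * V = 1\<^sub>m q" and N: "N \<in> carrier_mat n n"
    and S: "S \<in> carrier_mat p q"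
  shows "transpose_mat U * (M * (U * S * transpose_mat V) * N) * V = S"
proof -
  have "transpose_mat U * (M * (U * S * transpose_mat V) * N) * V =
      (transpose_mat U * M * U) * S * (transpose_mat V * N * V)"
    using assms(1) M V(1) N S by (simp add: mult_mat_assoc del: assoc_mult_mat)
  also have "\<dots> = S" using S by (simp add: U(2) V(2))
  finally show ?thesis .
qed

lemma orthonormal_coefficients_unique:
  fixes U V M N S T :: "real mat"
  assumes U: "U \<in> carrier_mat m p" "transpose_mat U * M * U = 1\<^sub>m p" and M: "M \<in> carrier_mat m m"
    and V: "V \<in> carrier_mat n q" "transpose_mat V * N * V = 1\<^sub>m q" and N: "N \<in> carrier_mat n n"
    and S: "S \<in> carrier_mat p q" and T: "T \<in> carrier_mat p q"
  shows "U * S * transpose_mat V = U * T * transpose_mat V \<longleftrightarrow> S = T"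
  using orthonormal_cancel[OF U M V N S] orthonormal_cancel[OF U M V N T] by metis

text \<open>\<open>Q Q\<^sup>T M\<close> is the \<open>M\<close>-orthogonal projection onto the range of \<open>Q\<close>.\<close>

lemma mat_mult_project_range:
  fixes Q C M :: "real mat"
  assumes Q: "Q \<in> carrier_mat m q" and C: "C \<in> carrier_mat q p" and M: "M \<in> carrier_mat m m"
    and orth: "transpose_mat Q * M * Q = 1\<^sub>m q"
  shows "Q * (transpose_mat Q * M * (Q * C)) = Q * C"
proof -
  have "transpose_mat Q * M * (Q * C) = transpose_mat Q * M * Q * C"
    using Q C M by (simp add: mult_mat_assoc del: assoc_mult_mat)
  then show ?thesis using orth C by simp
qed

text \<open>If the columns of \<open>B\<close> are a block of the factorized matrix, then \<open>B = Q C\<close> with \<open>C\<close> the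
  corresponding block of columns of \<open>R\<close>. Hence \<open>B\<close> lies in the range of \<open>Q\<close> and is fixed by the
  projection.\<close>

lemma gqr_project_block:
  fixes B M Q R :: "real mat"
  assumes g: "gqr (mat_of_cols m (as @ cols B @ bs)) M Q R" and B: "B \<in> carrier_mat m p"
    and M: "M \<in> carrier_mat m m"
  shows "Q * (transpose_mat Q * M * B) = B"
proof -
  define q where "q = dim_col Q"
  define C where "C = Matrix.mat q p (\<lambda>(i, j). R $$ (i, length as + j))"
  have Q: "Q \<in> carrier_mat m q" and R: "R \<in> carrier_mat q (length as + (p + length bs))"
    and eq: "mat_of_cols m (as @ cols B @ bs) = Q * R" and orth: "transpose_mat Q * M * Q = 1\<^sub>m q"
    using g B by (auto simp: gqr_def q_def)
  have C: "C \<in> carrier_mat q p" by (simp add: C_def)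
  have "B = Q * C"
  proof (rule eq_matI)
    fix i j assume "i < dim_row (Q * C)" "j < dim_col (Q * C)"
    then have ij: "i < m" "j < p" using Q C by auto
    have "B $$ (i, j) = mat_of_cols m (as @ cols B @ bs) $$ (i, length as + j)"
      using ij B by (simp add: mat_of_cols_index nth_append)
    also have "\<dots> = (Q * R) $$ (i, length as + j)" by (simp only: eq)
    also have "\<dots> = (Q * C) $$ (i, j)"
      using ij Q R by (auto simp: scalar_prod_def C_def intro!: sum.cong)
    finally show "B $$ (i, j) = (Q * C) $$ (i, j)" .
  qed (use B Q C in auto)
  then show ?thesis using mat_mult_project_range[OF Q C M orth] by simp
qed


section \<open>Matrix exponential and nonlinearity\<close>

lemma transpose_pow_mat:
  fixes A :: "real mat"
  assumes A: "A \<in> carrier_mat n n"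
  shows "transpose_mat A ^\<^sub>m l = transpose_mat (A ^\<^sub>m l)"
proof (induction l)
  case (Suc l)
  have "A * A ^\<^sub>m l = A ^\<^sub>m l * A"
  proof (induction l)
    case (Suc l)
    have "A * A ^\<^sub>m Suc l = (A * A ^\<^sub>m l) * A"
      using A by (simp add: mult_mat_assoc del: assoc_mult_mat)
    then show ?case by (simp add: Suc)
  qed (use A in simp)
  moreover have "transpose_mat A ^\<^sub>m Suc l = transpose_mat (A * A ^\<^sub>m l)"
    using A Suc by (simp add: transpose_mult_mat)
  ultimately show ?case by simp
qed (use A in simp)

lemma mat_exp_transpose:
  assumes A: "A \<in> carrier_mat n n"
  shows "mat_exp (transpose_mat A) = transpose_mat (mat_exp A)"
proof -
  have "(A ^\<^sub>m l) \<in> carrier_mat n n" for l using A by simp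
  then show ?thesis
    using A by (intro eq_matI) (auto simp: mat_exp_def transpose_pow_mat[OF A] intro!: suminf_cong)
qed

lemma mat_exp_carrier: "A \<in> carrier_mat n n \<Longrightarrow> mat_exp A \<in> carrier_mat n n"
  by (simp add: mat_exp_def)

lemma nonlin_carrier:
  assumes "W \<in> carrier_mat (npts X) (npts Y)"
  shows "nonlin X Y nl W \<in> carrier_mat (npts X) (npts Y)"
  using assms by (cases nl) (auto simp: hadamard_pow_def all_ones_def ones_mat_def)

section \<open>Linear and Galerkin steps\<close>

lemma mat_exp_laplacian_carrier:
  assumes "fe_discretization X"
  shows "mat_exp (s \<cdot>\<^sub>m discrete_laplacian X) \<in> carrier_mat (npts X) (npts X)"
  using mat_exp_carrier discrete_laplacian_carrier[OF assms] by simp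

text \<open>The operator exponentiates \<open>L\<^sub>y\<^sup>T\<close>, the algorithm \<open>L\<^sub>y\<close>; transposition commutes with the
  exponential.\<close>

lemma heat_op_fe_fun:
  assumes X: "fe_discretization X" and Y: "fe_discretization Y"
    and W: "W \<in> carrier_mat (npts X) (npts Y)"
  shows "heat_op X Y s (fe_fun X Y W) = fe_fun X Y
    (mat_exp (s \<cdot>\<^sub>m discrete_laplacian X) * W * transpose_mat (mat_exp (s \<cdot>\<^sub>m discrete_laplacian Y)))"
proof -
  have "s \<cdot>\<^sub>m transpose_mat (discrete_laplacian Y) = transpose_mat (s \<cdot>\<^sub>m discrete_laplacian Y)"
    by (rule eq_matI) auto
  moreover have "s \<cdot>\<^sub>m discrete_laplacian Y \<in> carrier_mat (npts Y) (npts Y)"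
    using discrete_laplacian_carrier[OF Y] by simp
  ultimately show ?thesis
    by (simp add: heat_op_def coeff_mat_fe_fun[OF X Y W] mat_exp_transpose)
qed

lemma linear_basesD:
  assumes X: "fe_discretization X" and Y: "fe_discretization Y"
    and lin: "linear_bases X Y s U V U1 R V1 P"
    and U: "U \<in> carrier_mat (npts X) r" and V: "V \<in> carrier_mat (npts Y) q"
  shows "U1 \<in> carrier_mat (npts X) r" "R \<in> carrier_mat r r"
    "V1 \<in> carrier_mat (npts Y) q" "P \<in> carrier_mat q q"
    "mat_exp (s \<cdot>\<^sub>m discrete_laplacian X) * U = U1 * R"
    "mat_exp (s \<cdot>\<^sub>m discrete_laplacian Y) * V = V1 * P"
    "transpose_mat U1 * mass X * U1 = 1\<^sub>m r" "transpose_mat V1 * mass Y * V1 = 1\<^sub>m q"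
proof -
  have EU: "mat_exp (s \<cdot>\<^sub>m discrete_laplacian X) * U \<in> carrier_mat (npts X) r"
    and FV: "mat_exp (s \<cdot>\<^sub>m discrete_laplacian Y) * V \<in> carrier_mat (npts Y) q"
    using mat_exp_laplacian_carrier[OF X, of s] mat_exp_laplacian_carrier[OF Y, of s] U V by simp_all
  have gX: "gqr (mat_exp (s \<cdot>\<^sub>m discrete_laplacian X) * U) (mass X) U1 R" "dim_col U1 = r"
    and gY: "gqr (mat_exp (s \<cdot>\<^sub>m discrete_laplacian Y) * V) (mass Y) V1 P" "dim_col V1 = q"
    using lin U V unfolding linear_bases_def by auto
  show "U1 \<in> carrier_mat (npts X) r" "R \<in> carrier_mat r r"
    "mat_exp (s \<cdot>\<^sub>m discrete_laplacian X) * U = U1 * R" "transpose_mat U1 * mass X * U1 = 1\<^sub>m r"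
    by (fact gqrD[OF gX(1) EU gX(2)])+
  show "V1 \<in> carrier_mat (npts Y) q" "P \<in> carrier_mat q q"
    "mat_exp (s \<cdot>\<^sub>m discrete_laplacian Y) * V = V1 * P" "transpose_mat V1 * mass Y * V1 = 1\<^sub>m q"
    by (fact gqrD[OF gY(1) FV gY(2)])+
qed

text \<open>The exponentials act on the two bases separately, so the exact flow stays in the span of
  \<open>U1\<close> and \<open>V1\<close>, where coefficients are unique.\<close>

lemma linear_step_iff:
  assumes X: "fe_discretization X" and Y: "fe_discretization Y"
    and lin: "linear_bases X Y s U V U1 R V1 P"
    and U: "U \<in> carrier_mat (npts X) r" and V: "V \<in> carrier_mat (npts Y) q"
    and S: "S \<in> carrier_mat r q" and T: "T \<in> carrier_mat r q"
  shows "(\<forall>z\<in>fe_domain X Y. fe_fun X Y (U1 * T * transpose_mat V1) z =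
      heat_op X Y s (fe_fun X Y (U * S * transpose_mat V)) z) \<longleftrightarrow> T = R * S * transpose_mat P"
proof -
  note D = linear_basesD[OF X Y lin U V]
  let ?E = "mat_exp (s \<cdot>\<^sub>m discrete_laplacian X)" and ?F = "mat_exp (s \<cdot>\<^sub>m discrete_laplacian Y)"
  note E = mat_exp_laplacian_carrier[OF X, of s] and F = mat_exp_laplacian_carrier[OF Y, of s]
  have "?E * (U * S * transpose_mat V) * transpose_mat ?F = (?E * U) * S * transpose_mat (?F * V)"
    using U V S E F by (simp add: mult_mat_assoc transpose_mult_mat del: assoc_mult_mat)
  also have "\<dots> = U1 * (R * S * transpose_mat P) * transpose_mat V1"
    unfolding D(5,6) using D(1-4) S by (simp add: mult_mat_assoc transpose_mult_mat del: assoc_mult_mat)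
  finally have flow: "?E * (U * S * transpose_mat V) * transpose_mat ?F =
      U1 * (R * S * transpose_mat P) * transpose_mat V1" .
  have W: "U * S * transpose_mat V \<in> carrier_mat (npts X) (npts Y)" using U V S by simp
  have lift: "U1 * A * transpose_mat V1 \<in> carrier_mat (npts X) (npts Y)" if "A \<in> carrier_mat r q" for A
    using D(1,3) that by simp
  have RSP: "R * S * transpose_mat P \<in> carrier_mat r q" using D(2,4) S by simp
  have "(\<forall>z\<in>fe_domain X Y. fe_fun X Y (U1 * T * transpose_mat V1) z =
      heat_op X Y s (fe_fun X Y (U * S * transpose_mat V)) z) \<longleftrightarrow>
      U1 * T * transpose_mat V1 = U1 * (R * S * transpose_mat P) * transpose_mat V1"
    unfolding heat_op_fe_fun[OF X Y W] flow
    by (rule fe_fun_eq_on_domain_iff[OF X Y]) (rule lift[OF T], rule lift[OF RSP])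
  also have "\<dots> \<longleftrightarrow> T = R * S * transpose_mat P"
    by (rule orthonormal_coefficients_unique[OF D(1,7) mass_carrier D(3,8) mass_carrier T RSP])
  finally show ?thesis .
qed

lemma ip_h_lowrank_test:
  assumes Z: "Z \<in> carrier_mat (npts X) (npts Y)" and U: "U \<in> carrier_mat (npts X) p"
    and V: "V \<in> carrier_mat (npts Y) q" and T: "T \<in> carrier_mat p q"
  shows "ip_h X Y (fe_fun X Y Z) (fe_fun X Y (U * T * transpose_mat V)) =
    ip_F (transpose_mat U * mass X * Z * mass Y * V) T"
proof -
  have "ip_h X Y (fe_fun X Y Z) (fe_fun X Y (U * T * transpose_mat V)) =
      ip_F (mass X * Z * mass Y) (U * T * transpose_mat V)"
    using U V T by (subst ip_h_fe_fun[OF Z]) (auto simp: ip_M_def)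
  also have "\<dots> = ip_F (transpose_mat U * (mass X * Z * mass Y) * V) T"
    by (rule ip_F_sandwich_right) (use Z U V T in auto)
  also have "transpose_mat U * (mass X * Z * mass Y) * V = transpose_mat U * mass X * Z * mass Y * V"
    using Z U V by (simp add: mult_mat_assoc del: assoc_mult_mat)
  finally show ?thesis .
qed

text \<open>The coefficient map is an isometry, because both bases are orthonormal. In the Galerkin relations
  this replaces the terms without nonlinearity by their coefficient matrices.\<close>

lemma ip_h_lowrank_lowrank:
  assumes U: "U \<in> carrier_mat (npts X) p" "transpose_mat U * mass X * U = 1\<^sub>m p"
    and V: "V \<in> carrier_mat (npts Y) q" "transpose_mat V * mass Y * V = 1\<^sub>m q"
    and S: "S \<in> carrier_mat p q" and T: "T \<in> carrier_mat p q"
  shows "ip_h X Y (fe_fun X Y (U * S * transpose_mat V)) (fe_fun X Y (U * T * transpose_mat V)) =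
    ip_F S T"
proof -
  have "transpose_mat U * mass X * (U * S * transpose_mat V) * mass Y * V =
      transpose_mat U * (mass X * (U * S * transpose_mat V) * mass Y) * V"
    using U(1) V(1) S by (simp add: mult_mat_assoc del: assoc_mult_mat)
  also have "\<dots> = S"
    by (rule orthonormal_cancel[OF U mass_carrier V mass_carrier S])
  finally show ?thesis
    using U(1) V(1) S T by (subst ip_h_lowrank_test[of _ X Y _ p _ q]) auto
qed

lemma ball_lowrank_space:
  assumes "U \<in> carrier_mat m p" "V \<in> carrier_mat n q"
  shows "(\<forall>v\<in>lowrank_space X Y U V. Q v) \<longleftrightarrow>
    (\<forall>T\<in>carrier_mat p q. Q (fe_fun X Y (U * T * transpose_mat V)))"
  unfolding lowrank_space_def carrier_matD(2)[OF assms(1)] carrier_matD(2)[OF assms(2)] by blast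

lemma lowrank_spaceI:
  assumes "U \<in> carrier_mat m p" "V \<in> carrier_mat n q" "S \<in> carrier_mat p q"
  shows "fe_fun X Y (U * S * transpose_mat V) \<in> lowrank_space X Y U V"
  unfolding lowrank_space_def carrier_matD(2)[OF assms(1)] carrier_matD(2)[OF assms(2)]
  using assms(3) by blast

text \<open>The augmented bases reproduce \<open>U1\<close> and \<open>V1\<close> because these are blocks of the matrices that were
  factorized.\<close>

lemma galerkin_basesD:
  assumes g: "galerkin_bases X Y nl \<tau> U1 S1 V1 U2 S2 V2 Ub Vb"
    and U1: "U1 \<in> carrier_mat (npts X) r" and V1: "V1 \<in> carrier_mat (npts Y) q"
  shows "Ub \<in> carrier_mat (npts X) (dim_col Ub)" "Vb \<in> carrier_mat (npts Y) (dim_col Ub)"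
    "transpose_mat Ub * mass X * Ub = 1\<^sub>m (dim_col Ub)"
    "transpose_mat Vb * mass Y * Vb = 1\<^sub>m (dim_col Ub)"
    "Ub * (transpose_mat Ub * mass X * U1) = U1" "Vb * (transpose_mat Vb * mass Y * V1) = V1"
proof -
  obtain bs cs R P where
    qX: "gqr (mat_of_cols (npts X) (Matrix.vec (npts X) (\<lambda>_. 1) # cols U1 @ bs)) (mass X) Ub R"
    and qY: "gqr (mat_of_cols (npts Y) (Matrix.vec (npts Y) (\<lambda>_. 1) # cols V1 @ cs)) (mass Y) Vb P"
    and dim: "dim_col Vb = dim_col Ub"
    using g unfolding galerkin_bases_def Let_def by blast
  show "Ub \<in> carrier_mat (npts X) (dim_col Ub)" "transpose_mat Ub * mass X * Ub = 1\<^sub>m (dim_col Ub)"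
    by (fact gqrD[OF qX mat_of_cols_carrier(1) refl])+
  show "Vb \<in> carrier_mat (npts Y) (dim_col Ub)" "transpose_mat Vb * mass Y * Vb = 1\<^sub>m (dim_col Ub)"
    by (fact gqrD[OF qY mat_of_cols_carrier(1) dim])+
  show "Ub * (transpose_mat Ub * mass X * U1) = U1"
    by (rule gqr_project_block[of _ "[Matrix.vec (npts X) (\<lambda>_. 1)]", OF _ U1 mass_carrier]) (simp, rule qX)
  show "Vb * (transpose_mat Vb * mass Y * V1) = V1"
    by (rule gqr_project_block[of _ "[Matrix.vec (npts Y) (\<lambda>_. 1)]", OF _ V1 mass_carrier]) (simp, rule qY)
qed


theorem lemma3p4:
  fixes X Y :: fe1d and nl :: nonlinearity
    and \<epsilon> \<tau> \<eta> s :: real and r rb rt :: nat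
    and U S V U1 R V1 P U2 S2 V2 Ub Vb :: "real mat"
    and S1 Sb1 Sb2 Sb3 U3 S3 V3 U' R' V' P' S' :: "real mat"
    and w w1 wb2 wb3 w3 w' :: "real \<times> real \<Rightarrow> real"
  assumes "fe_discretization X" and "fe_discretization Y" and "fe_deg X = fe_deg Y"
    and "\<epsilon> > 0" and "\<tau> > 0" and "\<eta> \<ge> 0" and s_def: "s = \<tau> / 2 * \<epsilon>\<^sup>2"
    \<comment> \<open>input\<close>
    and "U \<in> carrier_mat (npts X) r" and "S \<in> carrier_mat r r" and "V \<in> carrier_mat (npts Y) r"
    and "transpose_mat U * mass X * U = 1\<^sub>m r" and "transpose_mat V * mass Y * V = 1\<^sub>m r"
    \<comment> \<open>bases produced by the algorithm\<close>
    and "linear_bases X Y s U V U1 R V1 P"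
    and "bug_step X Y nl \<tau> U1 (R * S * transpose_mat P) V1 U2 S2 V2"
    and "galerkin_bases X Y nl \<tau> U1 (R * S * transpose_mat P) V1 U2 S2 V2 Ub Vb"
    and "dim_col Ub = rb"
    \<comment> \<open>arbitrary coefficients with respect to these bases\<close>
    and "S1 \<in> carrier_mat r r"
    and "Sb2 \<in> carrier_mat rb rb" and "Sb3 \<in> carrier_mat rb rb"
    and Sb1_def: "Sb1 = (transpose_mat Ub * mass X * U1) * S1 *
          transpose_mat (transpose_mat Vb * mass Y * V1)"
    and "nonlin_defined X Y nl (U1 * S1 * transpose_mat V1)"
    and "nonlin_defined X Y nl (Ub * Sb1 * transpose_mat Vb)"
    and "nonlin_defined X Y nl (Ub * Sb2 * transpose_mat Vb)"
    \<comment> \<open>truncation of \<open>Sb3\<close>, bases of the last linear step, and coefficients in them\<close>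
    and "truncation \<eta> rt Ub Sb3 Vb U3 S3 V3"
    and "linear_bases X Y s U3 V3 U' R' V' P'"
    and "S' \<in> carrier_mat rt rt"
    \<comment> \<open>the corresponding finite element functions\<close>
    and w_def: "w = fe_fun X Y (U * S * transpose_mat V)"
    and w1_def: "w1 = fe_fun X Y (U1 * S1 * transpose_mat V1)"
    and wb2_def: "wb2 = fe_fun X Y (Ub * Sb2 * transpose_mat Vb)"
    and wb3_def: "wb3 = fe_fun X Y (Ub * Sb3 * transpose_mat Vb)"
    and w3_def: "w3 = fe_fun X Y (U3 * S3 * transpose_mat V3)"
    and w'_def: "w' = fe_fun X Y (U' * S' * transpose_mat V')"
  shows "w \<in> lowrank_space X Y U V \<and> w1 \<in> lowrank_space X Y U1 V1 \<and>
         wb2 \<in> lowrank_space X Y Ub Vb \<and> wb3 \<in> lowrank_space X Y Ub Vb \<and>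
         w3 \<in> lowrank_space X Y U3 V3 \<and> w' \<in> lowrank_space X Y U' V' \<and>
         ((S1 = R * S * transpose_mat P \<and>
           Sb2 = Sb1 + \<tau> \<cdot>\<^sub>m (transpose_mat Ub * mass X *
             nonlin X Y nl (Ub * Sb1 * transpose_mat Vb) * mass Y * Vb) \<and>
           Sb3 = (1 / 2) \<cdot>\<^sub>m Sb1 + (1 / 2) \<cdot>\<^sub>m Sb2 + (\<tau> / 2) \<cdot>\<^sub>m (transpose_mat Ub * mass X *
             nonlin X Y nl (Ub * Sb2 * transpose_mat Vb) * mass Y * Vb) \<and>
           S' = R' * S3 * transpose_mat P')
          \<longleftrightarrow>
          ((\<forall>z\<in>fe_domain X Y. w1 z = heat_op X Y s w z) \<and>
           (\<forall>v\<in>lowrank_space X Y Ub Vb.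
              ip_h X Y wb2 v = ip_h X Y w1 v + \<tau> * ip_h X Y (nonlin_fun X Y nl w1) v) \<and>
           (\<forall>v\<in>lowrank_space X Y Ub Vb.
              ip_h X Y wb3 v = 1 / 2 * ip_h X Y w1 v + 1 / 2 * ip_h X Y wb2 v
                + \<tau> / 2 * ip_h X Y (nonlin_fun X Y nl wb2) v) \<and>
           (\<forall>z\<in>fe_domain X Y. w' z = heat_op X Y s w3 z)))"
proof -
  note X = assms(1) and Y = assms(2)
  note lin = assms(13) and gal = assms(15)
  have U: "U \<in> carrier_mat (npts X) r" and S: "S \<in> carrier_mat r r" and V: "V \<in> carrier_mat (npts Y) r"
    and S1: "S1 \<in> carrier_mat r r" and Sb2: "Sb2 \<in> carrier_mat rb rb" and Sb3: "Sb3 \<in> carrier_mat rb rb"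
    and S': "S' \<in> carrier_mat rt rt"
    by fact+
  note L = linear_basesD[OF X Y lin U V]
  note G = galerkin_basesD[OF gal L(1) L(3), unfolded \<open>dim_col Ub = rb\<close>]
  have Sb1: "Sb1 \<in> carrier_mat rb rb"
    unfolding Sb1_def using G(1,2) L(1,3) S1 by auto
  have U3: "U3 \<in> carrier_mat (npts X) rt" and V3: "V3 \<in> carrier_mat (npts Y) rt"
    and S3: "S3 \<in> carrier_mat rt rt"
    using \<open>truncation \<eta> rt Ub Sb3 Vb U3 S3 V3\<close> G(1,2) Sb3
    by (auto simp: truncation_def first_cols_def)
  note lin' = \<open>linear_bases X Y s U3 V3 U' R' V' P'\<close>
  note L' = linear_basesD[OF X Y lin' U3 V3]

  \<comment> \<open>the projection of the linear step onto the augmented bases is exact\<close>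
  have W1: "U1 * S1 * transpose_mat V1 = Ub * Sb1 * transpose_mat Vb"
  proof -
    let ?C = "transpose_mat Ub * mass X * U1" and ?D = "transpose_mat Vb * mass Y * V1"
    have C: "?C \<in> carrier_mat rb r" and D: "?D \<in> carrier_mat rb r"
      using G(1,2) L(1,3) by auto
    have "Ub * (C * S1 * transpose_mat D) * transpose_mat Vb = (Ub * C) * S1 * transpose_mat (Vb * D)"
      if "C \<in> carrier_mat rb r" "D \<in> carrier_mat rb r" for C D
      using that G(1,2) S1 by (simp add: mult_mat_assoc transpose_mult_mat del: assoc_mult_mat)
    from this[OF C D] show ?thesis by (simp only: Sb1_def G(5,6))
  qed

  let ?N = "nonlin X Y nl"
  let ?W1 = "Ub * Sb1 * transpose_mat Vb" and ?W2 = "Ub * Sb2 * transpose_mat Vb"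
  let ?proj = "\<lambda>Z. transpose_mat Ub * mass X * Z * mass Y * Vb"
  have cW: "?W1 \<in> carrier_mat (npts X) (npts Y)" "?W2 \<in> carrier_mat (npts X) (npts Y)"
    using G(1,2) Sb1 Sb2 by auto
  have cN: "?N ?W1 \<in> carrier_mat (npts X) (npts Y)" "?N ?W2 \<in> carrier_mat (npts X) (npts Y)"
    using nonlin_carrier cW by auto
  have cP: "?proj (?N ?W1) \<in> carrier_mat rb rb" "?proj (?N ?W2) \<in> carrier_mat rb rb"
    using cN G(1,2) by auto
  have w1: "w1 = fe_fun X Y ?W1" unfolding w1_def W1 ..
  have N1: "nonlin_fun X Y nl w1 = fe_fun X Y (?N ?W1)"
    and N2: "nonlin_fun X Y nl wb2 = fe_fun X Y (?N ?W2)"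
    using coeff_mat_fe_fun[OF X Y] cW by (simp_all add: nonlin_fun_def w1 wb2_def)
  note test = ip_h_lowrank_lowrank[OF G(1,3) G(2,4)] ip_h_lowrank_test[OF _ G(1) G(2)]

  have step2: "(\<forall>v\<in>lowrank_space X Y Ub Vb.
        ip_h X Y wb2 v = ip_h X Y w1 v + \<tau> * ip_h X Y (nonlin_fun X Y nl w1) v) \<longleftrightarrow>
      Sb2 = Sb1 + \<tau> \<cdot>\<^sub>m ?proj (?N ?W1)"
  proof -
    have "(\<forall>v\<in>lowrank_space X Y Ub Vb.
        ip_h X Y wb2 v = ip_h X Y w1 v + \<tau> * ip_h X Y (nonlin_fun X Y nl w1) v) \<longleftrightarrow>
      (\<forall>T\<in>carrier_mat rb rb. ip_F Sb2 T = ip_F (Sb1 + \<tau> \<cdot>\<^sub>m ?proj (?N ?W1)) T)"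
      unfolding ball_lowrank_space[OF G(1,2)] N1 unfolding w1 wb2_def
      by (intro ball_cong refl) (simp only: test Sb1 Sb2 cN cP
          ip_F_add_left[OF Sb1] ip_F_smult_left[OF cP(1)] smult_carrier_mat)
    also have "\<dots> \<longleftrightarrow> Sb2 = Sb1 + \<tau> \<cdot>\<^sub>m ?proj (?N ?W1)"
      by (rule ip_F_nondegenerate[OF Sb2]) (intro add_carrier_mat, simp only: smult_carrier_mat cP)
    finally show ?thesis .
  qed
  have step3: "(\<forall>v\<in>lowrank_space X Y Ub Vb.
        ip_h X Y wb3 v = 1 / 2 * ip_h X Y w1 v + 1 / 2 * ip_h X Y wb2 v
          + \<tau> / 2 * ip_h X Y (nonlin_fun X Y nl wb2) v) \<longleftrightarrow>
      Sb3 = (1 / 2) \<cdot>\<^sub>m Sb1 + (1 / 2) \<cdot>\<^sub>m Sb2 + (\<tau> / 2) \<cdot>\<^sub>m ?proj (?N ?W2)"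
  proof -
    have c: "(1 / 2) \<cdot>\<^sub>m Sb1 \<in> carrier_mat rb rb" "(1 / 2) \<cdot>\<^sub>m Sb2 \<in> carrier_mat rb rb"
      "(1 / 2) \<cdot>\<^sub>m Sb1 + (1 / 2) \<cdot>\<^sub>m Sb2 \<in> carrier_mat rb rb"
      "(\<tau> / 2) \<cdot>\<^sub>m ?proj (?N ?W2) \<in> carrier_mat rb rb"
      using Sb1 Sb2 cP by (simp_all del: assoc_mult_mat)
    have "(\<forall>v\<in>lowrank_space X Y Ub Vb.
        ip_h X Y wb3 v = 1 / 2 * ip_h X Y w1 v + 1 / 2 * ip_h X Y wb2 v
          + \<tau> / 2 * ip_h X Y (nonlin_fun X Y nl wb2) v) \<longleftrightarrow>
      (\<forall>T\<in>carrier_mat rb rb. ip_F Sb3 T =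
        ip_F ((1 / 2) \<cdot>\<^sub>m Sb1 + (1 / 2) \<cdot>\<^sub>m Sb2 + (\<tau> / 2) \<cdot>\<^sub>m ?proj (?N ?W2)) T)"
      unfolding ball_lowrank_space[OF G(1,2)] N2 unfolding w1 wb2_def wb3_def
      by (intro ball_cong refl) (simp only: test Sb1 Sb2 Sb3 cN ip_F_add_left[OF c(3,4)]
          ip_F_add_left[OF c(1,2)] ip_F_smult_left[OF cP(2)] ip_F_smult_left[OF Sb1] ip_F_smult_left[OF Sb2])
    also have "\<dots> \<longleftrightarrow> Sb3 = (1 / 2) \<cdot>\<^sub>m Sb1 + (1 / 2) \<cdot>\<^sub>m Sb2 + (\<tau> / 2) \<cdot>\<^sub>m ?proj (?N ?W2)"
      by (rule ip_F_nondegenerate[OF Sb3 add_carrier_mat[OF c(4)]])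
    finally show ?thesis .
  qed
  have step1: "(\<forall>z\<in>fe_domain X Y. w1 z = heat_op X Y s w z) \<longleftrightarrow> S1 = R * S * transpose_mat P"
    unfolding w1_def w_def by (rule linear_step_iff[OF X Y lin U V S S1])
  have step5: "(\<forall>z\<in>fe_domain X Y. w' z = heat_op X Y s w3 z) \<longleftrightarrow> S' = R' * S3 * transpose_mat P'"
    unfolding w'_def w3_def by (rule linear_step_iff[OF X Y lin' U3 V3 S3 S'])
  have mem: "w \<in> lowrank_space X Y U V" "w1 \<in> lowrank_space X Y U1 V1"
    "wb2 \<in> lowrank_space X Y Ub Vb" "wb3 \<in> lowrank_space X Y Ub Vb"
    "w3 \<in> lowrank_space X Y U3 V3" "w' \<in> lowrank_space X Y U' V'"
    unfolding w_def w1_def wb2_def wb3_def w3_def w'_def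
    by (rule lowrank_spaceI[OF U V S] lowrank_spaceI[OF L(1,3) S1] lowrank_spaceI[OF G(1,2) Sb2]
        lowrank_spaceI[OF G(1,2) Sb3] lowrank_spaceI[OF U3 V3 S3] lowrank_spaceI[OF L'(1,3) S'])+
  show ?thesis
    unfolding step1 step2 step3 step5 by (intro conjI mem refl)
qed

end
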